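(* Let $E$ be an Archimedean Riesz space and let $\ell_0^\infty$ be the Riesz space of eventually constant real sequences (with coordinatewise order). Then $\mathcal{L}^{r}(E,\ell_0^\infty)$ has the Riesz-Kantorovich property: for each $T\in\mathcal{L}^r(E,\ell_0^\infty)$ such that $T^+=\sup\{T,0\}$ exists in $\mathcal{L}^r(E,\ell_0^\infty)$, one has $T^+(x)=\sup\{T(y)\mid y\in[0,x]\}$ (supremum in $\ell_0^\infty$) for each $x\in E_+$.
   Context: Riesz space = vector lattice. $\mathcal{L}^r(E,F)$ is the space of regular operators (differences of positive linear operators) $E\to F$, ordered by $S\le T$ iff $S(x)\le T(x)$ for all $x\in E_+$; it need not be a lattice. *)

theory Defs
  imports Complex_Main "HOL-Library.Lub_Glb"
begin

class riesz_space = ordered_real_vector + lattice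

class archimedean_riesz_space = riesz_space +
  assumes archimedean: "0 \<le> x \<Longrightarrow> (\<And>n::nat. real n *\<^sub>R x \<le> y) \<Longrightarrow> x = 0"

typedef eventually_constant =
    "{f :: nat \<Rightarrow> real. \<exists>c. \<forall>\<^sub>F n in sequentially. f n = c}"
  morphisms seq_nth Abs_eventually_constant
  by (rule exI[of _ "\<lambda>_. 0"]) auto

setup_lifting type_definition_eventually_constant

lemma eventually_constant_map2:
  fixes f g :: "nat \<Rightarrow> real" and h :: "real \<Rightarrow> real \<Rightarrow> real"
  assumes "\<exists>c. \<forall>\<^sub>F n in sequentially. f n = c"
    and "\<exists>c. \<forall>\<^sub>F n in sequentially. g n = c"
  shows "\<exists>c. \<forall>\<^sub>F n in sequentially. h (f n) (g n) = c"
proof -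
  from assms obtain c d where
    "\<forall>\<^sub>F n in sequentially. f n = c" and "\<forall>\<^sub>F n in sequentially. g n = d"
    by blast
  then have "\<forall>\<^sub>F n in sequentially. h (f n) (g n) = h c d"
    by eventually_elim simp
  then show ?thesis ..
qed

instantiation eventually_constant :: riesz_space
begin

lift_definition zero_eventually_constant :: eventually_constant is "\<lambda>_. 0"
  by auto

lift_definition plus_eventually_constant ::
  "eventually_constant \<Rightarrow> eventually_constant \<Rightarrow> eventually_constant"
  is "\<lambda>f g n. f n + g n" by (rule eventually_constant_map2)

lift_definition minus_eventually_constant ::
  "eventually_constant \<Rightarrow> eventually_constant \<Rightarrow> eventually_constant"
  is "\<lambda>f g n. f n - g n" by (rule eventually_constant_map2)

lift_definition uminus_eventually_constant :: "eventually_constant \<Rightarrow> eventually_constant"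
  is "\<lambda>f n. - f n" by (rule eventually_constant_map2)

lift_definition scaleR_eventually_constant ::
  "real \<Rightarrow> eventually_constant \<Rightarrow> eventually_constant"
  is "\<lambda>r f n. r * f n" by (rule eventually_constant_map2)

lift_definition less_eq_eventually_constant ::
  "eventually_constant \<Rightarrow> eventually_constant \<Rightarrow> bool"
  is "\<lambda>f g. \<forall>n. f n \<le> g n" .

definition less_eventually_constant ::
  "eventually_constant \<Rightarrow> eventually_constant \<Rightarrow> bool"
  where "f < g \<longleftrightarrow> f \<le> g \<and> \<not> g \<le> f" for f g :: eventually_constant

lift_definition sup_eventually_constant ::
  "eventually_constant \<Rightarrow> eventually_constant \<Rightarrow> eventually_constant"
  is "\<lambda>f g n. max (f n) (g n)" by (rule eventually_constant_map2)

lift_definition inf_eventually_constant ::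
  "eventually_constant \<Rightarrow> eventually_constant \<Rightarrow> eventually_constant"
  is "\<lambda>f g n. min (f n) (g n)" by (rule eventually_constant_map2)

instance
proof
  fix a b c :: eventually_constant and r s :: real
  show "a + b + c = a + (b + c)" by transfer (simp add: fun_eq_iff)
  show "a + b = b + a" by transfer (simp add: fun_eq_iff)
  show "0 + a = a" by transfer simp
  show "- a + a = 0" by transfer simp
  show "a - b = a + - b" by transfer simp
  show "r *\<^sub>R (a + b) = r *\<^sub>R a + r *\<^sub>R b" by transfer (simp add: algebra_simps)
  show "(r + s) *\<^sub>R a = r *\<^sub>R a + s *\<^sub>R a" by transfer (simp add: algebra_simps)
  show "r *\<^sub>R s *\<^sub>R a = (r * s) *\<^sub>R a" by transfer (simp add: algebra_simps)
  show "1 *\<^sub>R a = a" by transfer simp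
  show "a < b \<longleftrightarrow> a \<le> b \<and> \<not> b \<le> a" by (rule less_eventually_constant_def)
  show "a \<le> a" by transfer simp
  show "a \<le> b \<Longrightarrow> b \<le> c \<Longrightarrow> a \<le> c" by transfer (blast intro: order_trans)
  show "a \<le> b \<Longrightarrow> b \<le> a \<Longrightarrow> a = b" by transfer (simp add: fun_eq_iff order_antisym)
  show "a \<le> b \<Longrightarrow> c + a \<le> c + b" by transfer simp
  show "a \<le> b \<Longrightarrow> 0 \<le> r \<Longrightarrow> r *\<^sub>R a \<le> r *\<^sub>R b" by transfer (simp add: mult_left_mono)
  show "r \<le> s \<Longrightarrow> 0 \<le> a \<Longrightarrow> r *\<^sub>R a \<le> s *\<^sub>R a" by transfer (simp add: mult_right_mono)
  show "inf a b \<le> a" by transfer simp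
  show "inf a b \<le> b" by transfer simp
  show "a \<le> b \<Longrightarrow> a \<le> c \<Longrightarrow> a \<le> inf b c" by transfer simp
  show "a \<le> sup a b" by transfer simp
  show "b \<le> sup a b" by transfer simp
  show "b \<le> a \<Longrightarrow> c \<le> a \<Longrightarrow> sup b c \<le> a" by transfer simp
qed

end

definition positive_operator :: "('a::riesz_space \<Rightarrow> 'b::riesz_space) \<Rightarrow> bool"
  where "positive_operator T \<longleftrightarrow> linear T \<and> (\<forall>x\<ge>0. 0 \<le> T x)"

definition regular :: "('a::riesz_space \<Rightarrow> 'b::riesz_space) \<Rightarrow> bool"
  where "regular T \<longleftrightarrow>
    (\<exists>P Q. positive_operator P \<and> positive_operator Q \<and> T = (\<lambda>x. P x - Q x))"

lemma positive_operator_zero: "positive_operator (\<lambda>_. 0)"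
  by (simp add: positive_operator_def linear_iff)

lemma positive_operator_add:
  "positive_operator S \<Longrightarrow> positive_operator T \<Longrightarrow> positive_operator (\<lambda>x. S x + T x)"
  by (auto simp: positive_operator_def intro: linear_compose_add)

lemma positive_operator_scale:
  "0 \<le> r \<Longrightarrow> positive_operator T \<Longrightarrow> positive_operator (\<lambda>x. r *\<^sub>R T x)"
  by (auto simp: positive_operator_def intro: linear_compose_scale_right scaleR_nonneg_nonneg)

lemma regular_zero: "regular (\<lambda>_. 0)"
  unfolding regular_def using positive_operator_zero by force

lemma regular_add:
  assumes "regular S" and "regular T"
  shows "regular (\<lambda>x. S x + T x)"
proof -
  from assms obtain P Q P' Q' where
    pos: "positive_operator P" "positive_operator Q" "positive_operator P'" "positive_operator Q'"
    and eq: "S = (\<lambda>x. P x - Q x)" "T = (\<lambda>x. P' x - Q' x)"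
    unfolding regular_def by blast
  have "(\<lambda>x. S x + T x) = (\<lambda>x. (P x + P' x) - (Q x + Q' x))"
    by (simp add: eq algebra_simps)
  with pos show ?thesis
    unfolding regular_def by (blast intro: positive_operator_add)
qed

lemma regular_uminus:
  assumes "regular T"
  shows "regular (\<lambda>x. - T x)"
proof -
  from assms obtain P Q where
    pos: "positive_operator P" "positive_operator Q" and eq: "T = (\<lambda>x. P x - Q x)"
    unfolding regular_def by blast
  have "(\<lambda>x. - T x) = (\<lambda>x. Q x - P x)" by (simp add: eq)
  with pos show ?thesis unfolding regular_def by blast
qed

lemma regular_diff: "regular S \<Longrightarrow> regular T \<Longrightarrow> regular (\<lambda>x. S x - T x)"
  using regular_add[of S "\<lambda>x. - T x"] regular_uminus[of T] by simp

lemma regular_scale: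
  assumes "regular T"
  shows "regular (\<lambda>x. r *\<^sub>R T x)"
proof -
  have nonneg: "regular (\<lambda>x. s *\<^sub>R T x)" if "0 \<le> s" for s
  proof -
    from assms obtain P Q where
      pos: "positive_operator P" "positive_operator Q" and eq: "T = (\<lambda>x. P x - Q x)"
      unfolding regular_def by blast
    have "(\<lambda>x. s *\<^sub>R T x) = (\<lambda>x. s *\<^sub>R P x - s *\<^sub>R Q x)"
      by (simp add: eq scaleR_diff_right)
    with pos that show ?thesis
      unfolding regular_def by (blast intro: positive_operator_scale)
  qed
  show ?thesis
    using nonneg[of r] regular_uminus[OF nonneg[of "- r"]] by (cases "0 \<le> r") auto
qed

lemma regular_linear: "regular T \<Longrightarrow> linear T"
  by (auto simp: regular_def positive_operator_def intro: linear_compose_sub)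

lemma linear_eq_on_positive_cone:
  fixes S T :: "'a::riesz_space \<Rightarrow> 'b::riesz_space"
  assumes "linear S" and "linear T" and eq: "\<And>x. 0 \<le> x \<Longrightarrow> S x = T x"
  shows "S = T"
proof
  fix x
  have "S (sup x 0 - (sup x 0 - x)) = T (sup x 0 - (sup x 0 - x))"
    using eq[of "sup x 0"] eq[of "sup x 0 - x"]
    unfolding linear_diff[OF \<open>linear S\<close>, of "sup x 0" "sup x 0 - x"]
      linear_diff[OF \<open>linear T\<close>, of "sup x 0" "sup x 0 - x"] by simp
  then show "S x = T x" by simp
qed

typedef (overloaded) ('a::riesz_space, 'b::riesz_space) regular_operator =
    "{T :: 'a \<Rightarrow> 'b. regular T}"
  morphisms apply_op Abs_regular_operator
  using regular_zero by blast

setup_lifting type_definition_regular_operator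

instantiation regular_operator :: (riesz_space, riesz_space) ordered_real_vector
begin

lift_definition zero_regular_operator :: "('a, 'b) regular_operator"
  is "\<lambda>_. 0" by (rule regular_zero)

lift_definition plus_regular_operator ::
  "('a, 'b) regular_operator \<Rightarrow> ('a, 'b) regular_operator \<Rightarrow> ('a, 'b) regular_operator"
  is "\<lambda>S T x. S x + T x" by (rule regular_add)

lift_definition minus_regular_operator ::
  "('a, 'b) regular_operator \<Rightarrow> ('a, 'b) regular_operator \<Rightarrow> ('a, 'b) regular_operator"
  is "\<lambda>S T x. S x - T x" by (rule regular_diff)

lift_definition uminus_regular_operator ::
  "('a, 'b) regular_operator \<Rightarrow> ('a, 'b) regular_operator"
  is "\<lambda>T x. - T x" by (rule regular_uminus)

lift_definition scaleR_regular_operator ::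
  "real \<Rightarrow> ('a, 'b) regular_operator \<Rightarrow> ('a, 'b) regular_operator"
  is "\<lambda>r T x. r *\<^sub>R T x" by (rule regular_scale)

lift_definition less_eq_regular_operator ::
  "('a, 'b) regular_operator \<Rightarrow> ('a, 'b) regular_operator \<Rightarrow> bool"
  is "\<lambda>S T. \<forall>x\<ge>0. S x \<le> T x" .

definition less_regular_operator ::
  "('a, 'b) regular_operator \<Rightarrow> ('a, 'b) regular_operator \<Rightarrow> bool"
  where "S < T \<longleftrightarrow> S \<le> T \<and> \<not> T \<le> S" for S T :: "('a, 'b) regular_operator"

instance
proof
  fix a b c :: "('a, 'b) regular_operator" and r s :: real
  show "a + b + c = a + (b + c)" by transfer (simp add: add.assoc)
  show "a + b = b + a" by transfer (simp add: add.commute)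
  show "0 + a = a" by transfer simp
  show "- a + a = 0" by transfer simp
  show "a - b = a + - b" by transfer simp
  show "r *\<^sub>R (a + b) = r *\<^sub>R a + r *\<^sub>R b" by transfer (simp add: scaleR_add_right)
  show "(r + s) *\<^sub>R a = r *\<^sub>R a + s *\<^sub>R a" by transfer (simp add: scaleR_add_left)
  show "r *\<^sub>R s *\<^sub>R a = (r * s) *\<^sub>R a" by transfer simp
  show "1 *\<^sub>R a = a" by transfer simp
  show "a < b \<longleftrightarrow> a \<le> b \<and> \<not> b \<le> a" by (rule less_regular_operator_def)
  show "a \<le> a" by transfer simp
  show "a \<le> b \<Longrightarrow> b \<le> c \<Longrightarrow> a \<le> c" by transfer (blast intro: order_trans)
  show "a \<le> b \<Longrightarrow> b \<le> a \<Longrightarrow> a = b"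
    by transfer (blast intro: linear_eq_on_positive_cone regular_linear order_antisym)
  show "a \<le> b \<Longrightarrow> c + a \<le> c + b" by transfer simp
  show "a \<le> b \<Longrightarrow> 0 \<le> r \<Longrightarrow> r *\<^sub>R a \<le> r *\<^sub>R b" by transfer (simp add: scaleR_left_mono)
  show "r \<le> s \<Longrightarrow> 0 \<le> a \<Longrightarrow> r *\<^sub>R a \<le> s *\<^sub>R a" by transfer (simp add: scaleR_right_mono)
qed

end

end

theory Submission imports Defs begin

text \<open>
  The sequence space contains every finitely supported sequence, so one coordinate of an eventually
  constant sequence can be changed freely. This forces the supremum of \<open>T\<close> and \<open>0\<close>, when there
  is one, to be formed coordinate by coordinate.

  Let \<open>S = T\<^sup>+\<close>, and write \<open>T\<^sub>n\<close>, \<open>S\<^sub>n\<close> for the coordinate functionals. Because the real numbers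
  are Dedekind complete, the classical Riesz--Kantorovich argument shows that each \<open>T\<^sub>n\<close> has a
  positive part \<open>F\<close>, with \<open>F x\<close> the supremum of \<open>T\<^sub>n y\<close> over \<open>0 \<le> y \<le> x\<close>
  (lemma \<open>functional_positive_part\<close>). Replacing the coordinate \<open>S\<^sub>n\<close> of \<open>S\<close> by \<open>F\<close> gives a
  positive operator, again with values in the eventually constant sequences, which still dominates
  \<open>T\<close>. Since \<open>S\<close> is the least such operator, \<open>S\<^sub>n \<le> F\<close> on the positive cone. Hence every upper bound
  of the sequences \<open>T y\<close> dominates \<open>S x\<close> in each coordinate.
\<close>

lemma isLub_UNIV_iff:
  "isLub UNIV A s \<longleftrightarrow> (\<forall>a\<in>A. a \<le> s) \<and> (\<forall>u. (\<forall>a\<in>A. a \<le> u) \<longrightarrow> s \<le> u)"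
  by (auto simp: isLub_def leastP_def isUb_def setle_def setge_def)

text \<open>The witnesses are \<open>inf z x\<close> and its complement in \<open>z\<close>: both \<open>z - y \<le> z\<close> and
  \<open>z - y \<le> x\<close>, so that complement is at most \<open>y\<close>.\<close>

lemma riesz_decomposition:
  fixes x y z :: "'a::riesz_space"
  assumes "0 \<le> x" "0 \<le> y" "0 \<le> z" "z \<le> x + y"
  obtains a b where "a \<in> {0..x}" "b \<in> {0..y}" "z = a + b"
proof
  show "inf z x \<in> {0..x}" using assms by simp
  have "z - y \<le> inf z x" using assms by (intro le_infI) (auto simp: diff_le_eq)
  then have "z - inf z x \<le> y" by (metis diff_le_eq add.commute)
  then show "z - inf z x \<in> {0..y}" by simp
qed simp

text \<open>Kantorovich's extension: every vector is a difference \<open>a - b\<close> of positive ones, and additivity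
  makes \<open>f a - f b\<close> independent of the choice of the two.\<close>

lemma kantorovich_extension:
  fixes f :: "'a::riesz_space \<Rightarrow> 'b::real_vector"
  assumes add: "\<And>x y. 0 \<le> x \<Longrightarrow> 0 \<le> y \<Longrightarrow> f (x + y) = f x + f y"
    and scale: "\<And>r x. 0 \<le> r \<Longrightarrow> 0 \<le> x \<Longrightarrow> f (r *\<^sub>R x) = r *\<^sub>R f x"
  obtains F where "linear F" "\<And>x. 0 \<le> x \<Longrightarrow> F x = f x"
proof
  define F where "F x = f (sup x 0) - f (sup x 0 - x)" for x
  have F_diff: "F (a - b) = f a - f b" if "0 \<le> a" "0 \<le> b" for a b
  proof -
    let ?p = "sup (a - b) 0"
    have "f a + f (?p - (a - b)) = f (a + (?p - (a - b)))"
      by (rule add[symmetric]) (use that in auto)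
    also have "a + (?p - (a - b)) = b + ?p" by simp
    also have "f (b + ?p) = f b + f ?p"
      by (rule add) (use that in auto)
    finally show ?thesis by (simp add: F_def algebra_simps)
  qed
  have split: "\<exists>a b. 0 \<le> a \<and> 0 \<le> b \<and> x = a - b" for x :: 'a
    by (rule exI[of _ "sup x 0"], rule exI[of _ "sup x 0 - x"]) simp
  show "linear F"
  proof (rule linearI)
    fix x y :: 'a
    obtain a b c d where pos: "0 \<le> a" "0 \<le> b" "0 \<le> c" "0 \<le> d"
      and xy: "x = a - b" "y = c - d"
      using split[of x] split[of y] by blast
    have "F (x + y) = F ((a + c) - (b + d))" by (simp add: xy algebra_simps)
    also have "\<dots> = (f a + f c) - (f b + f d)"
      using pos by (subst F_diff) (auto simp: add)
    finally show "F (x + y) = F x + F y"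
      using pos by (simp add: xy F_diff)
  next
    fix r and x :: 'a
    obtain a b where pos: "0 \<le> a" "0 \<le> b" and x: "x = a - b"
      using split[of x] by blast
    show "F (r *\<^sub>R x) = r *\<^sub>R F x"
    proof (cases "0 \<le> r")
      case True
      have "r *\<^sub>R x = r *\<^sub>R a - r *\<^sub>R b" by (simp add: x scaleR_diff_right)
      with True pos show ?thesis
        by (simp add: x F_diff scale scaleR_nonneg_nonneg scaleR_diff_right)
    next
      case False
      have "r *\<^sub>R x = (- r) *\<^sub>R b - (- r) *\<^sub>R a" by (simp add: x scaleR_diff_right)
      also have "F \<dots> = (- r) *\<^sub>R f b - (- r) *\<^sub>R f a"
        using False pos by (subst F_diff) (auto simp: scale[of "- r", simplified] scaleR_nonneg_nonneg
            scaleR_nonpos_nonneg)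
      finally show ?thesis using pos by (simp add: x F_diff scaleR_diff_right)
    qed
  qed
  show "F x = f x" if "0 \<le> x" for x
    using F_diff[of x 0] scale[of 0 0] that by simp
qed

text \<open>The Riesz--Kantorovich formula for functionals. Additivity of the supremum is where the Riesz
  decomposition enters: it identifies \<open>{0..x + y}\<close> with the sums of elements of \<open>{0..x}\<close>
  and \<open>{0..y}\<close>.\<close>

lemma functional_positive_part:
  fixes \<phi> :: "'a::riesz_space \<Rightarrow> real"
  assumes lin: "linear \<phi>"
    and bdd: "\<And>x. 0 \<le> x \<Longrightarrow> bdd_above (\<phi> ` {0..x})"
  obtains F where "linear F" "\<And>x. 0 \<le> x \<Longrightarrow> F x = (SUP y\<in>{0..x}. \<phi> y)"
proof -
  let ?f = "\<lambda>x. SUP y\<in>{0..x}. \<phi> y"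
  have upper: "\<phi> y \<le> ?f x" if "0 \<le> y" "y \<le> x" for x y
    using that bdd[of x] by (intro cSUP_upper) auto
  have least: "?f x \<le> c" if "0 \<le> x" "\<And>y. 0 \<le> y \<Longrightarrow> y \<le> x \<Longrightarrow> \<phi> y \<le> c" for x c
    using that by (intro cSUP_least) auto
  have add: "?f (x + y) = ?f x + ?f y" if pos: "0 \<le> x" "0 \<le> y" for x y
  proof (rule antisym)
    show "?f (x + y) \<le> ?f x + ?f y"
    proof (rule least)
      fix z assume "0 \<le> z" "z \<le> x + y"
      then obtain a b where "a \<in> {0..x}" "b \<in> {0..y}" "z = a + b"
        using riesz_decomposition pos by blast
      then show "\<phi> z \<le> ?f x + ?f y"
        using upper[of a x] upper[of b y] by (simp add: linear_add[OF lin])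
    qed (use pos in simp)
    have "?f x \<le> ?f (x + y) - ?f y"
    proof (rule least[OF pos(1)])
      fix a assume a: "0 \<le> a" "a \<le> x"
      have "?f y \<le> ?f (x + y) - \<phi> a"
      proof (rule least[OF pos(2)])
        fix b assume "0 \<le> b" "b \<le> y"
        with a have "\<phi> (a + b) \<le> ?f (x + y)"
          by (intro upper) (auto intro: add_mono)
        then show "\<phi> b \<le> ?f (x + y) - \<phi> a" by (simp add: linear_add[OF lin])
      qed
      then show "\<phi> a \<le> ?f (x + y) - ?f y" by simp
    qed
    then show "?f x + ?f y \<le> ?f (x + y)" by simp
  qed
  have scale_le: "r * ?f x \<le> ?f (r *\<^sub>R x)" if "0 < r" "0 \<le> x" for r x
  proof -
    have "?f x \<le> ?f (r *\<^sub>R x) / r"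
    proof (rule least[OF that(2)])
      fix y assume "0 \<le> y" "y \<le> x"
      with that have "\<phi> (r *\<^sub>R y) \<le> ?f (r *\<^sub>R x)"
        by (intro upper) (auto intro: scaleR_left_mono scaleR_nonneg_nonneg)
      with that show "\<phi> y \<le> ?f (r *\<^sub>R x) / r"
        by (simp add: linear_scale[OF lin] field_simps)
    qed
    with that show ?thesis by (simp add: field_simps)
  qed
  have scale: "?f (r *\<^sub>R x) = r *\<^sub>R ?f x" if "0 \<le> r" "0 \<le> x" for r x
  proof (cases "r = 0")
    case True
    then show ?thesis by (simp add: linear_0[OF lin])
  next
    case False
    with that have "0 < r" by simp
    \<comment> \<open>The reverse inequality is the same one for the factor \<open>inverse r\<close>.\<close>
    have "?f (r *\<^sub>R x) \<le> r * ?f x"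
      using scale_le[of "inverse r" "r *\<^sub>R x"] \<open>0 < r\<close> that
      by (simp add: scaleR_nonneg_nonneg field_simps)
    with scale_le[OF \<open>0 < r\<close> \<open>0 \<le> x\<close>] show ?thesis by simp
  qed
  from add scale show thesis
    by (rule kantorovich_extension[of ?f]) (auto intro: that)
qed

lift_definition update_coordinate ::
  "eventually_constant \<Rightarrow> nat \<Rightarrow> real \<Rightarrow> eventually_constant"
  is "\<lambda>f n c. f(n := c)"
proof -
  fix f :: "nat \<Rightarrow> real" and n c
  assume "\<exists>d. \<forall>\<^sub>F k in sequentially. f k = d"
  then obtain d where "\<forall>\<^sub>F k in sequentially. f k = d" ..
  moreover have "\<forall>\<^sub>F k in sequentially. n < k" by (rule eventually_gt_at_top)
  ultimately have "\<forall>\<^sub>F k in sequentially. (f(n := c)) k = d"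
    by eventually_elim simp
  then show "\<exists>d. \<forall>\<^sub>F k in sequentially. (f(n := c)) k = d" ..
qed

lemma linear_seq_nth:
  assumes "linear T"
  shows "linear (\<lambda>x. seq_nth (T x) n)"
  by (rule linearI)
    (simp_all add: linear_add[OF assms] linear_scale[OF assms]
      plus_eventually_constant.rep_eq scaleR_eventually_constant.rep_eq)

lemma positive_operator_update_coordinate:
  assumes S: "positive_operator S"
    and F: "linear F" "\<And>x. 0 \<le> x \<Longrightarrow> 0 \<le> F x"
  shows "positive_operator (\<lambda>x. update_coordinate (S x) n (F x))"
  unfolding positive_operator_def
proof (intro conjI allI impI linearI)
  from S have lin: "linear S" and pos: "\<And>x. 0 \<le> x \<Longrightarrow> 0 \<le> S x"
    by (auto simp: positive_operator_def)
  show "update_coordinate (S (x + y)) n (F (x + y)) =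
      update_coordinate (S x) n (F x) + update_coordinate (S y) n (F y)" for x y
    unfolding linear_add[OF lin] linear_add[OF F(1)] by transfer auto
  show "update_coordinate (S (r *\<^sub>R x)) n (F (r *\<^sub>R x)) =
      r *\<^sub>R update_coordinate (S x) n (F x)" for r x
    unfolding linear_scale[OF lin] linear_scale[OF F(1)] real_scaleR_def by transfer auto
  show "0 \<le> update_coordinate (S x) n (F x)" if "0 \<le> x" for x
    using pos[OF that] F(2)[OF that] by transfer simp
qed

lemma regular_functional_bdd_above:
  assumes "regular T" "0 \<le> x"
  shows "bdd_above ((\<lambda>y. seq_nth (T y) n) ` {0..x})"
proof -
  from \<open>regular T\<close> obtain P Q where P: "positive_operator P" and Q: "positive_operator Q"
    and T: "T = (\<lambda>x. P x - Q x)" by (auto simp: regular_def)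
  have "T y \<le> P x" if "0 \<le> y" "y \<le> x" for y
  proof -
    have "0 \<le> Q y" "0 \<le> P (x - y)" "linear P"
      using P Q that by (auto simp: positive_operator_def)
    then have "P y - Q y \<le> P y" "P y \<le> P x"
      by (auto simp: linear_diff)
    then show ?thesis unfolding T by (rule order_trans)
  qed
  then show ?thesis
    by (auto simp: less_eq_eventually_constant.rep_eq intro!: bdd_aboveI[of _ "seq_nth (P x) n"])
qed

text \<open>The heart of the matter: minimality of \<open>S\<close> is tested against \<open>S\<close> with its coordinate \<open>n\<close>
  replaced by the positive part of the functional \<open>T\<^sub>n\<close>.\<close>

lemma positive_part_coordinate_le:
  fixes T S :: "('e::riesz_space, eventually_constant) regular_operator"
  assumes lub: "isLub UNIV {T, 0} S" and x: "0 \<le> x"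
  shows "seq_nth (apply_op S x) n \<le> (SUP y\<in>{0..x}. seq_nth (apply_op T y) n)"
proof -
  have T: "regular (apply_op T)" and S: "regular (apply_op S)"
    using apply_op by auto
  have "T \<le> S" "0 \<le> S" and least: "\<And>U. T \<le> U \<Longrightarrow> 0 \<le> U \<Longrightarrow> S \<le> U"
    using lub by (auto simp: isLub_UNIV_iff)
  then have TS: "\<And>y. 0 \<le> y \<Longrightarrow> apply_op T y \<le> apply_op S y"
    and S_pos: "positive_operator (apply_op S)"
    using regular_linear[OF S]
    by (auto simp: less_eq_regular_operator.rep_eq zero_regular_operator.rep_eq
        positive_operator_def)
  let ?\<phi> = "\<lambda>y. seq_nth (apply_op T y) n"
  have lin: "linear ?\<phi>" using regular_linear[OF T] by (rule linear_seq_nth)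
  note bdd = regular_functional_bdd_above[OF T, of _ n]
  obtain F where F: "linear F" "\<And>x. 0 \<le> x \<Longrightarrow> F x = (SUP y\<in>{0..x}. ?\<phi> y)"
    using functional_positive_part[OF lin bdd] by blast
  have F_upper: "?\<phi> y \<le> F x" if "0 \<le> y" "y \<le> x" for x y
    using that bdd[of x] by (subst F(2)) (auto intro!: cSUP_upper)
  have F_pos: "0 \<le> F x" if "0 \<le> x" for x
    using F_upper[of 0 x] that linear_0[OF lin] by simp
  let ?U = "\<lambda>x. update_coordinate (apply_op S x) n (F x)"
  have U_pos: "positive_operator ?U"
    using S_pos F(1) F_pos by (rule positive_operator_update_coordinate)
  then have "regular ?U"
    unfolding regular_def using positive_operator_zero by force
  then have apply_U: "apply_op (Abs_regular_operator ?U) = ?U"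
    by (simp add: Abs_regular_operator_inverse)
  have "S \<le> Abs_regular_operator ?U"
  proof (rule least)
    show "T \<le> Abs_regular_operator ?U"
      unfolding less_eq_regular_operator.rep_eq apply_U
      using TS F_upper
      by (auto simp: less_eq_eventually_constant.rep_eq update_coordinate.rep_eq)
    show "0 \<le> Abs_regular_operator ?U"
      using U_pos
      by (simp add: less_eq_regular_operator.rep_eq apply_U zero_regular_operator.rep_eq
          positive_operator_def)
  qed
  then have "apply_op S x \<le> ?U x"
    using x by (simp add: less_eq_regular_operator.rep_eq apply_U)
  then have "seq_nth (apply_op S x) n \<le> seq_nth (?U x) n"
    by (simp add: less_eq_eventually_constant.rep_eq)
  then show ?thesis by (simp add: update_coordinate.rep_eq F(2)[OF x])
qed

theorem theorem4p2:
  fixes T T_plus :: "('e::archimedean_riesz_space, eventually_constant) regular_operator"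
    and x :: 'e
  assumes "isLub UNIV {T, 0} T_plus"
    and "0 \<le> x"
  shows "isLub UNIV {apply_op T y | y. y \<in> {0..x}} (apply_op T_plus x)"
  unfolding isLub_UNIV_iff
proof (intro conjI ballI allI impI)
  fix a assume "a \<in> {apply_op T y | y. y \<in> {0..x}}"
  then obtain y where a: "a = apply_op T y" and y: "0 \<le> y" "y \<le> x" by auto
  have "T \<le> T_plus" "0 \<le> T_plus"
    using assms(1) by (auto simp: isLub_UNIV_iff)
  then have "apply_op T y \<le> apply_op T_plus y" "0 \<le> apply_op T_plus (x - y)"
    using y by (auto simp: less_eq_regular_operator.rep_eq zero_regular_operator.rep_eq)
  moreover have "linear (apply_op T_plus)"
    using apply_op[of T_plus] by (auto intro: regular_linear)
  ultimately show "a \<le> apply_op T_plus x"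
    by (auto simp: a linear_diff intro: order_trans)
next
  fix u assume u: "\<forall>a\<in>{apply_op T y | y. y \<in> {0..x}}. a \<le> u"
  have "seq_nth (apply_op T_plus x) n \<le> seq_nth u n" for n
  proof -
    have "(SUP y\<in>{0..x}. seq_nth (apply_op T y) n) \<le> seq_nth u n"
      using u \<open>0 \<le> x\<close> by (intro cSUP_least) (auto simp: less_eq_eventually_constant.rep_eq)
    with positive_part_coordinate_le[OF assms] show ?thesis by (rule order_trans)
  qed
  then show "apply_op T_plus x \<le> u" by (simp add: less_eq_eventually_constant.rep_eq)
qed

end
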